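(* Let $\Gamma(\mathbb{Z}_n)$ be the co-maximal graph of $\mathbb{Z}_n$, $n\ge 2$. Then the following hold. (i) If $n=pq$, where $p<q$ are primes, then the domination polynomial of $\Gamma(\mathbb{Z}_n)$ is $$D(\Gamma(\mathbb{Z}_n),x)=\sum_{i=0}^{pq}\binom{pq}{i}x^{i}-\sum_{i=0}^{p+q-1}\binom{p+q-1}{i}x^{i}+x\sum_{i=1}^{p-1}\binom{p-1}{i}x^{i}\sum_{j=1}^{q-1}\binom{q-1}{j}x^{j}+x^{p}+x^{q}.$$ (ii) If $n=p^{n_1}q^{n_2}$, where $p<q$ are primes and $n_1,n_2$ are positive integers, then the domination polynomial of $\Gamma(\mathbb{Z}_n)$ is $$D(\Gamma(\mathbb{Z}_n),x)=\sum_{i=0}^{n}\binom{n}{i}x^{i}-\sum_{i=0}^{n-\phi(n)}\binom{n-\phi(n)}{i}x^{i}+x^{\frac{n}{pq}}\sum_{i=1}^{\frac{n(q-1)}{pq}}\binom{\frac{n(q-1)}{pq}}{i}x^{i}\sum_{j=1}^{\frac{n(p-1)}{pq}}\binom{\frac{n(p-1)}{pq}}{j}x^{j}+x^{\frac{n(q-1)}{pq}}+x^{\frac{n(p-1)}{pq}}.$$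
   Context: All graphs are finite, simple and undirected. The co-maximal graph $\Gamma(\mathbb{Z}_n)$ of the ring $\mathbb{Z}_n$ of integers modulo $n$ has vertex set $\mathbb{Z}_n$, and two distinct elements $a,b$ are adjacent if and only if $a\mathbb{Z}_n+b\mathbb{Z}_n=\mathbb{Z}_n$. A dominating set of a graph $G$ is a non-empty set $S\subseteq V(G)$ such that every vertex of $V(G)\setminus S$ is adjacent to at least one vertex of $S$. The domination polynomial of $G$ is $D(G,x)=\sum_{k} D(G,k)x^k$, where $D(G,k)$ is the number of dominating sets of $G$ of cardinality $k$. $\phi$ is Euler's totient function.
   Formalization: In (ii) the last two terms are corrected: they are multiplied by x^{n/(pq)}, i.e. x^{n/(pq)}(x^{n(q-1)/(pq)} + x^{n(p-1)/(pq)}), since the printed formula is false (for n=6 it contradicts (i)). *)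

theory Defs
  imports
    "HOL-Number_Theory.Number_Theory"
    "HOL-Computational_Algebra.Polynomial"
    "Graph_Theory.Pair_Digraph"
begin

text \<open>
  Finite simple undirected graphs are the \<open>pair_graph\<close>s of the Graph_Theory library: an edge
  between \<open>a\<close> and \<open>b\<close> is represented by both arcs \<open>(a, b)\<close> and \<open>(b, a)\<close>.
\<close>

definition comaximal_graph :: "('a, 'm) ring_scheme \<Rightarrow> 'a pair_pre_digraph" where
  "comaximal_graph R =
     \<lparr> pverts = carrier R,
       parcs = {(a, b). a \<in> carrier R \<and> b \<in> carrier R \<and> a \<noteq> b \<and>
                        (PIdl\<^bsub>R\<^esub> a) <+>\<^bsub>R\<^esub> (PIdl\<^bsub>R\<^esub> b) = carrier R} \<rparr>"

lemma pair_graph_comaximal_graph: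
  assumes "cring R" "finite (carrier R)"
  shows "pair_graph (comaximal_graph R)"
proof -
  interpret cring R by fact
  have sub: "PIdl\<^bsub>R\<^esub> a \<subseteq> carrier R" if "a \<in> carrier R" for a
    using that by (auto simp: cgenideal_def)
  have comm: "(PIdl\<^bsub>R\<^esub> a) <+>\<^bsub>R\<^esub> (PIdl\<^bsub>R\<^esub> b) = (PIdl\<^bsub>R\<^esub> b) <+>\<^bsub>R\<^esub> (PIdl\<^bsub>R\<^esub> a)"
    if "a \<in> carrier R" "b \<in> carrier R" for a b
    using set_add_comm[OF sub[OF that(1)] sub[OF that(2)]] .
  let ?G = "comaximal_graph R"
  have arcs: "parcs ?G \<subseteq> carrier R \<times> carrier R" and verts: "pverts ?G = carrier R"
    by (auto simp: comaximal_graph_def)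
  have loopfree: "a \<noteq> b" if "(a, b) \<in> parcs ?G" for a b
    using that by (simp add: comaximal_graph_def)
  have "sym (parcs ?G)"
  proof (rule symI)
    fix a b assume "(a, b) \<in> parcs ?G"
    then show "(b, a) \<in> parcs ?G"
      using comm[of a b] unfolding comaximal_graph_def by auto
  qed
  then have sym: "symmetric (with_proj ?G)"
    by (simp add: symmetric_def arcs_ends_def arc_to_ends_def)
  have fin: "finite (parcs ?G)"
    using finite_subset[OF arcs] assms(2) by simp
  show ?thesis
    by unfold_locales (use arcs verts loopfree sym fin assms(2) in auto)
qed

text \<open>The ring $\mathbb{Z}_n$, with representatives \<open>{0..n - 1}\<close>.\<close>

abbreviation comaximal_graph_Z :: "nat \<Rightarrow> int pair_pre_digraph" where
  "comaximal_graph_Z n \<equiv> comaximal_graph (residue_ring (int n))"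

lemma pair_graph_comaximal_graph_Z:
  assumes "n \<ge> 2"
  shows "pair_graph (comaximal_graph_Z n)"
proof -
  interpret residues "int n" "residue_ring (int n)"
    using assms by unfold_locales auto
  show ?thesis
    by (rule pair_graph_comaximal_graph) (auto intro: cring)
qed

definition dominating_set :: "'a pair_pre_digraph \<Rightarrow> 'a set \<Rightarrow> bool" where
  "dominating_set G S \<longleftrightarrow>
     S \<noteq> {} \<and> S \<subseteq> pverts G \<and> (\<forall>v \<in> pverts G - S. \<exists>u \<in> S. (v, u) \<in> parcs G)"

definition num_dominating_sets :: "'a pair_pre_digraph \<Rightarrow> nat \<Rightarrow> nat" where
  "num_dominating_sets G k = card {S. dominating_set G S \<and> card S = k}"

definition domination_poly :: "'a pair_pre_digraph \<Rightarrow> int poly" where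
  "domination_poly G =
     (\<Sum>k = 0..card (pverts G). monom (of_nat (num_dominating_sets G k)) k)"

text \<open>The indeterminate of the polynomial ring.\<close>

abbreviation X :: "int poly" where
  "X \<equiv> [:0, 1:]"

text \<open>
  Pitfall in the formula for $n = p^{n_1} q^{n_2}$: in the source the factor $x^{n/(pq)}$ is
  printed in front of the product of the two sums only. The two monomials
  $x^{n(q-1)/(pq)}$ and $x^{n(p-1)/(pq)}$ that follow have to be inside its scope as well, since
  every dominating set without units contains all $n/(pq)$ multiples of $pq$. Without these
  parentheses the formula is false for every such $n$, and for $n_1 = n_2 = 1$ it contradicts
  the formula for $n = pq$, whose last terms are $x^p + x^q$ and not $x^{p-1} + x^{q-1}$.
  The theorem is stated with the parentheses.
\<close>

end

theory Submission
  imports Defs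
begin

text \<open>
  Sort the residues modulo $n = p^{n_1} q^{n_2}$ by which of the primes $p$, $q$ divide them:
  the units \<open>U\<close>, the residues \<open>P\<close> divisible by $p$ only, the residues \<open>Q\<close> divisible by $q$ only,
  and the multiples \<open>Z\<close> of $pq$. By Bezout, $a$ and $b$ are co-maximal iff $\gcd(a, b, n) = 1$, that
  is, iff neither prime divides both. So the graph is determined by the classes: a unit is adjacent
  to every other vertex, \<open>P\<close> and \<open>Q\<close> form a complete bipartite graph, and there are no further edges
  (\<open>adjacent_residues_iff\<close>).

  Hence every set that meets \<open>U\<close> dominates. A set \<open>S\<close> that avoids \<open>U\<close> has to contain \<open>Z\<close>, whose
  members have only units as neighbours; and if \<open>S\<close> misses \<open>P\<close>, then nothing but \<open>S\<close> itself can
  cover \<open>Q\<close>, so that \<open>S\<close> is \<open>Z \<union> Q\<close>, and symmetrically. Thus \<open>S\<close> is \<open>Z \<union> Q\<close>, or \<open>Z \<union> P\<close>, or \<open>Z\<close>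
  together with non-empty parts of both \<open>P\<close> and \<open>Q\<close> (\<open>dominating_sets_by_classes\<close>). The domination
  polynomial enumerates the dominating sets by size, and such enumerators turn disjoint families
  into sums and independent choices into products (\<open>size_enumerator_independent_unions\<close>). This
  gives the polynomial in terms of the sizes of the classes, which are
  $\phi(n)$, $n(q-1)/(pq)$, $n(p-1)/(pq)$ and $n/(pq)$. The formula for $n = pq$ is the case of
  exponents one.
\<close>

section \<open>Enumerating families of finite sets by size\<close>

definition size_enumerator :: "'a set set \<Rightarrow> int poly" where
  "size_enumerator F = (\<Sum>S\<in>F. X ^ card S)"

lemma size_enumerator_by_coefficients:
  assumes "finite F" and "\<And>S. S \<in> F \<Longrightarrow> card S \<le> m"
  shows "size_enumerator F = (\<Sum>k = 0..m. of_nat (card {S \<in> F. card S = k}) * X ^ k)"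
proof -
  have "size_enumerator F = (\<Sum>k = 0..m. \<Sum>S | S \<in> F \<and> card S = k. X ^ card S)"
    unfolding size_enumerator_def
    by (rule sum.group[symmetric]) (use assms in auto)
  also have "\<dots> = (\<Sum>k = 0..m. of_nat (card {S \<in> F. card S = k}) * X ^ k)"
    by (intro sum.cong refl) simp
  finally show ?thesis .
qed

lemma size_enumerator_Pow:
  assumes "finite A"
  shows "size_enumerator (Pow A) = (\<Sum>i = 0..card A. of_nat (card A choose i) * X ^ i)"
proof -
  have "{S \<in> Pow A. card S = k} = {S. S \<subseteq> A \<and> card S = k}" for k by auto
  then show ?thesis
    using size_enumerator_by_coefficients[of "Pow A" "card A"] assms
    by (simp add: card_mono n_subsets)
qed

lemma size_enumerator_Diff:
  assumes "finite F" "H \<subseteq> F"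
  shows "size_enumerator (F - H) = size_enumerator F - size_enumerator H"
  unfolding size_enumerator_def using assms by (rule sum_diff)

lemma size_enumerator_Un_disjoint:
  assumes "finite F" "finite H" "F \<inter> H = {}"
  shows "size_enumerator (F \<union> H) = size_enumerator F + size_enumerator H"
  unfolding size_enumerator_def using assms by (rule sum.union_disjoint)

lemma size_enumerator_nonempty_subsets:
  assumes "finite A"
  shows "size_enumerator (Pow A - {{}}) = (\<Sum>i = 1..card A. of_nat (card A choose i) * X ^ i)"
proof -
  have "size_enumerator (Pow A - {{}}) = size_enumerator (Pow A) - 1"
    using assms by (subst size_enumerator_Diff) (auto simp: size_enumerator_def)
  also have "\<dots> = (\<Sum>i = 1..card A. of_nat (card A choose i) * X ^ i)"
    by (simp add: size_enumerator_Pow[OF assms] sum.atLeast_Suc_atMost[of 0])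
  finally show ?thesis .
qed

text \<open>
  Sizes add up when a subset of \<open>A\<close> is joined with a subset of a disjoint \<open>B\<close>, so choosing the two
  parts independently multiplies the enumerators.
\<close>

lemma size_enumerator_independent_unions:
  assumes "finite A" "finite B" "A \<inter> B = {}" and F: "F \<subseteq> Pow A" and H: "H \<subseteq> Pow B"
  shows "size_enumerator {S \<union> T | S T. S \<in> F \<and> T \<in> H} = size_enumerator F * size_enumerator H"
proof -
  \<comment> \<open>A union determines its two parts: they are its traces on \<open>A\<close> and on \<open>B\<close>.\<close>
  have inj: "inj_on (\<lambda>(S, T). S \<union> T) (F \<times> H)"
  proof (rule inj_on_inverseI)
    fix ST assume "ST \<in> F \<times> H"
    then obtain S T where ST: "ST = (S, T)" and "S \<in> F" "T \<in> H" by (rule SigmaE)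
    then have "S \<subseteq> A" "T \<subseteq> B" using F H by auto
    then have "(S \<union> T) \<inter> A = S" "(S \<union> T) \<inter> B = T" using assms(3) by auto
    then show "(\<lambda>W. (W \<inter> A, W \<inter> B)) ((\<lambda>(S, T). S \<union> T) ST) = ST"
      by (simp add: ST)
  qed
  have card: "card (S \<union> T) = card S + card T" if "S \<in> F" "T \<in> H" for S T
  proof (rule card_Un_disjoint)
    have sub: "S \<subseteq> A" "T \<subseteq> B" using that F H by auto
    show "finite S" by (rule finite_subset[OF sub(1) assms(1)])
    show "finite T" by (rule finite_subset[OF sub(2) assms(2)])
    show "S \<inter> T = {}" using sub assms(3) by auto
  qed
  have "{S \<union> T | S T. S \<in> F \<and> T \<in> H} = (\<lambda>(S, T). S \<union> T) ` (F \<times> H)" by auto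
  then have "size_enumerator {S \<union> T | S T. S \<in> F \<and> T \<in> H} = (\<Sum>(S, T)\<in>F \<times> H. X ^ card (S \<union> T))"
    unfolding size_enumerator_def
    by (simp only: comp_def case_prod_unfold sum.reindex[OF inj[unfolded case_prod_unfold]])
  also have "\<dots> = (\<Sum>(S, T)\<in>F \<times> H. X ^ card S * X ^ card T)"
    by (intro sum.cong refl) (auto simp: card power_add)
  also have "\<dots> = size_enumerator F * size_enumerator H"
    by (simp add: size_enumerator_def sum_product sum.cartesian_product)
  finally show ?thesis .
qed

lemma domination_poly_eq_size_enumerator:
  assumes "finite (pverts G)"
  shows "domination_poly G = size_enumerator {S. dominating_set G S}"
proof -
  have sub: "{S. dominating_set G S} \<subseteq> Pow (pverts G)"
    by (auto simp: dominating_set_def)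
  have "size_enumerator {S. dominating_set G S} =
      (\<Sum>k = 0..card (pverts G). of_nat (card {S \<in> {S. dominating_set G S}. card S = k}) * X ^ k)"
    using sub assms
    by (intro size_enumerator_by_coefficients) (auto intro: finite_subset card_mono)
  also have "\<dots> = domination_poly G"
    unfolding domination_poly_def num_dominating_sets_def
    by (intro sum.cong refl) (simp add: monom_altdef of_nat_poly)
  finally show ?thesis ..
qed

section \<open>Domination in a graph determined by four vertex classes\<close>

text \<open>
  A set that meets \<open>U\<close> dominates everything at once. For a set \<open>S\<close> without members of \<open>U\<close> each
  other class has at most one source of domination: \<open>Z\<close> has none and must lie in \<open>S\<close>, while
  \<open>P\<close> is dominated by any member of \<open>S \<inter> Q\<close> and otherwise must lie in \<open>S\<close>, and vice versa. As \<open>P\<close> and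
  \<open>Q\<close> are inhabited, at most one of them can be missed by \<open>S\<close>, and then the other is contained in
  \<open>S\<close>.
\<close>

lemma dominating_sets_by_classes:
  assumes verts: "pverts G = U \<union> P \<union> Q \<union> Z"
    and disj: "U \<inter> P = {}" "U \<inter> Q = {}" "U \<inter> Z = {}" "P \<inter> Q = {}" "P \<inter> Z = {}" "Q \<inter> Z = {}"
    and nonempty: "P \<noteq> {}" "Q \<noteq> {}"
    and adj: "\<And>a b. a \<in> pverts G \<Longrightarrow> b \<in> pverts G \<Longrightarrow> (a, b) \<in> parcs G \<longleftrightarrow>
        a \<noteq> b \<and> (a \<in> U \<or> b \<in> U \<or> (a \<in> P \<and> b \<in> Q) \<or> (a \<in> Q \<and> b \<in> P))"
  shows "{S. dominating_set G S} =
      (Pow (pverts G) - Pow (P \<union> Q \<union> Z)) \<union>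
      ({Z \<union> W | W. W \<in> {A \<union> B | A B. A \<in> Pow P - {{}} \<and> B \<in> Pow Q - {{}}}} \<union> {Z \<union> P, Z \<union> Q})"
    (is "_ = ?M \<union> (?N \<union> _)")
proof (rule Set.set_eqI)
  fix S
  \<comment> \<open>The exact condition imposed by each class, before the cases are listed. It forces \<open>S\<close> to be
    non-empty: a set that misses \<open>U\<close> and \<open>P\<close> contains the inhabited class \<open>Q\<close>.\<close>
  have dom_iff: "dominating_set G S \<longleftrightarrow> S \<subseteq> pverts G \<and>
      (S \<inter> U \<noteq> {} \<or> (Z \<subseteq> S \<and> (S \<inter> P \<noteq> {} \<or> Q \<subseteq> S) \<and> (S \<inter> Q \<noteq> {} \<or> P \<subseteq> S)))"
    (is "_ \<longleftrightarrow> S \<subseteq> pverts G \<and> ?C")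
  proof (cases "S \<subseteq> pverts G")
    case S: True
    have reached: "(\<exists>u\<in>S. (v, u) \<in> parcs G) \<longleftrightarrow>
        (\<exists>u\<in>S. v \<in> U \<or> u \<in> U \<or> (v \<in> P \<and> u \<in> Q) \<or> (v \<in> Q \<and> u \<in> P))"
      if "v \<in> pverts G - S" for v
      using that S adj by (metis DiffD1 DiffD2 subsetD)
    have dom: "dominating_set G S \<longleftrightarrow> S \<noteq> {} \<and> (\<forall>v\<in>pverts G - S.
        \<exists>u\<in>S. v \<in> U \<or> u \<in> U \<or> (v \<in> P \<and> u \<in> Q) \<or> (v \<in> Q \<and> u \<in> P))"
      using S reached by (simp add: dominating_set_def)
    show ?thesis
    proof
      assume D: "dominating_set G S"
      have ?C
      proof (cases "S \<inter> U = {}")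
        case True
        have cover: "v \<in> S \<or> (v \<in> P \<and> S \<inter> Q \<noteq> {}) \<or> (v \<in> Q \<and> S \<inter> P \<noteq> {})"
          if v: "v \<in> pverts G" "v \<notin> U" for v
        proof (cases "v \<in> S")
          case False
          then obtain u where "u \<in> S" "u \<in> U \<or> (v \<in> P \<and> u \<in> Q) \<or> (v \<in> Q \<and> u \<in> P)"
            using D v unfolding dom by blast
          then show ?thesis using True by blast
        qed simp
        have "v \<in> S" if v: "v \<in> Z" for v
        proof -
          have "v \<in> pverts G" "v \<notin> U" "v \<notin> P" "v \<notin> Q" using v verts disj by auto
          then show ?thesis using cover[of v] by simp
        qed
        moreover have "v \<in> S" if v: "v \<in> Q" and "S \<inter> P = {}" for v
        proof -
          have "v \<in> pverts G" "v \<notin> U" "v \<notin> P" using v verts disj by auto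
          then show ?thesis using cover[of v] that by simp
        qed
        moreover have "v \<in> S" if v: "v \<in> P" and "S \<inter> Q = {}" for v
        proof -
          have "v \<in> pverts G" "v \<notin> U" "v \<notin> Q" using v verts disj by auto
          then show ?thesis using cover[of v] that by simp
        qed
        ultimately show ?thesis by blast
      qed simp
      with S show "S \<subseteq> pverts G \<and> ?C" ..
    next
      assume "S \<subseteq> pverts G \<and> ?C"
      then have C: ?C ..
      then have "S \<noteq> {}" using nonempty by blast
      moreover have "\<exists>u\<in>S. v \<in> U \<or> u \<in> U \<or> (v \<in> P \<and> u \<in> Q) \<or> (v \<in> Q \<and> u \<in> P)"
        if v: "v \<in> pverts G - S" for v
      proof -
        consider "v \<in> U" | "v \<in> P" | "v \<in> Q" | "v \<in> Z" using v verts by blast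
        then show ?thesis
        proof cases
          case 1
          then show ?thesis using \<open>S \<noteq> {}\<close> by blast
        next
          case 2
          then show ?thesis using C v by blast
        next
          case 3
          then show ?thesis using C v by blast
        next
          case 4
          then show ?thesis using C v by blast
        qed
      qed
      ultimately show "dominating_set G S"
        unfolding dom by blast
    qed
  qed (simp add: dominating_set_def)
  show "S \<in> {S. dominating_set G S} \<longleftrightarrow> S \<in> ?M \<union> (?N \<union> {Z \<union> P, Z \<union> Q})"
  proof (cases "S \<subseteq> pverts G \<and> S \<inter> U = {}")
    case True
    then have S: "S \<subseteq> P \<union> Q \<union> Z" using verts by blast
    have N: "S \<in> ?N \<longleftrightarrow> Z \<subseteq> S \<and> S \<inter> P \<noteq> {} \<and> S \<inter> Q \<noteq> {}"
    proof
      assume meets: "Z \<subseteq> S \<and> S \<inter> P \<noteq> {} \<and> S \<inter> Q \<noteq> {}"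
      then have eq: "S = Z \<union> ((S \<inter> P) \<union> (S \<inter> Q))" using S by auto
      have mem: "(S \<inter> P) \<union> (S \<inter> Q) \<in> {A \<union> B | A B. A \<in> Pow P - {{}} \<and> B \<in> Pow Q - {{}}}"
        using meets by (intro CollectI exI conjI refl) auto
      show "S \<in> ?N"
        by (rule CollectI, rule exI[of _ "(S \<inter> P) \<union> (S \<inter> Q)"], rule conjI[OF eq mem])
    qed auto
    have "S = Z \<union> P \<longleftrightarrow> Z \<subseteq> S \<and> P \<subseteq> S \<and> S \<inter> Q = {}"
      using S disj by auto
    moreover have "S = Z \<union> Q \<longleftrightarrow> Z \<subseteq> S \<and> Q \<subseteq> S \<and> S \<inter> P = {}"
      using S disj by auto
    moreover have "P \<subseteq> S \<Longrightarrow> S \<inter> P \<noteq> {}" "Q \<subseteq> S \<Longrightarrow> S \<inter> Q \<noteq> {}"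
      using nonempty by auto
    moreover have "S \<notin> ?M" using S by simp
    moreover have "dominating_set G S \<longleftrightarrow>
        Z \<subseteq> S \<and> (S \<inter> P \<noteq> {} \<or> Q \<subseteq> S) \<and> (S \<inter> Q \<noteq> {} \<or> P \<subseteq> S)"
      using True dom_iff by simp
    ultimately have "dominating_set G S \<longleftrightarrow> S \<in> ?M \<or> S \<in> ?N \<or> S = Z \<union> P \<or> S = Z \<union> Q"
      using N by argo
    then show ?thesis
      by (simp only: Un_iff insert_iff empty_iff mem_Collect_eq simp_thms)
  next
    case False
    show ?thesis
    proof (cases "S \<subseteq> pverts G")
      case True
      then have meets: "S \<inter> U \<noteq> {}" using False by blast
      then have "S \<in> ?M" using True disj by auto
      moreover have "dominating_set G S" using dom_iff True meets by simp
      ultimately show ?thesis by simp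
    next
      case outside: False
      have "\<not> dominating_set G S" using outside by (simp add: dominating_set_def)
      moreover have "S \<notin> ?M \<union> (?N \<union> {Z \<union> P, Z \<union> Q})"
      proof
        assume "S \<in> ?M \<union> (?N \<union> {Z \<union> P, Z \<union> Q})"
        then have "S \<subseteq> pverts G" unfolding verts by auto
        with outside show False ..
      qed
      ultimately show ?thesis by (simp only: mem_Collect_eq simp_thms)
    qed
  qed
qed

text \<open>
  The two binomial sums count the sets that meet \<open>U\<close>, as all sets of vertices minus those that
  avoid \<open>U\<close>. The remaining dominating sets all contain \<open>Z\<close>, whence the factor \<open>X ^ z\<close>; the bracket
  enumerates what they add to it, where the sums from $1$ enumerate the non-empty parts of \<open>P\<close> and \<open>Q\<close>.
\<close>

lemma domination_poly_by_classes:
  assumes fin: "finite (pverts G)"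
    and verts: "pverts G = U \<union> P \<union> Q \<union> Z"
    and disj: "U \<inter> P = {}" "U \<inter> Q = {}" "U \<inter> Z = {}" "P \<inter> Q = {}" "P \<inter> Z = {}" "Q \<inter> Z = {}"
    and nonempty: "P \<noteq> {}" "Q \<noteq> {}"
    and adj: "\<And>a b. a \<in> pverts G \<Longrightarrow> b \<in> pverts G \<Longrightarrow> (a, b) \<in> parcs G \<longleftrightarrow>
        a \<noteq> b \<and> (a \<in> U \<or> b \<in> U \<or> (a \<in> P \<and> b \<in> Q) \<or> (a \<in> Q \<and> b \<in> P))"
    and u: "card U = u" and k: "card P = k" and l: "card Q = l" and z: "card Z = z"
    and n: "card (pverts G) = n"
  shows "domination_poly G =
      (\<Sum>i = 0..n. of_nat (n choose i) * X ^ i)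
      - (\<Sum>i = 0..n - u. of_nat (n - u choose i) * X ^ i)
      + X ^ z * ((\<Sum>i = 1..k. of_nat (k choose i) * X ^ i) * (\<Sum>j = 1..l. of_nat (l choose j) * X ^ j)
                 + X ^ k + X ^ l)"
proof -
  define M where "M = Pow (pverts G) - Pow (P \<union> Q \<union> Z)"
  define W where "W = {A \<union> B | A B. A \<in> Pow P - {{}} \<and> B \<in> Pow Q - {{}}}"
  define N where "N = {Z \<union> C | C. C \<in> W}"
  have fins: "finite U" "finite P" "finite Q" "finite Z"
    using fin unfolding verts by auto
  have "P \<union> Q \<union> Z = pverts G - U"
    using verts disj by blast
  then have cardPQZ: "card (P \<union> Q \<union> Z) = n - u"
    using n u fins verts card_Diff_subset[of U "pverts G"] by auto
  have W_sub: "W \<subseteq> Pow (P \<union> Q)" unfolding W_def by blast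
  then have N_sub: "N \<subseteq> Pow (P \<union> Q \<union> Z)" unfolding N_def by blast
  have finN: "finite N" and finM: "finite M"
    using N_sub fins fin by (auto intro: finite_subset simp: M_def)
  have "size_enumerator M =
      (\<Sum>i = 0..n. of_nat (n choose i) * X ^ i) - (\<Sum>i = 0..n - u. of_nat (n - u choose i) * X ^ i)"
  proof -
    have "P \<union> Q \<union> Z \<subseteq> pverts G" using verts by blast
    then show ?thesis
      unfolding M_def using fin fins size_enumerator_Pow[OF fin] size_enumerator_Pow[of "P \<union> Q \<union> Z"]
      by (subst size_enumerator_Diff) (auto simp: cardPQZ n)
  qed
  moreover have "size_enumerator N =
      X ^ z * ((\<Sum>i = 1..k. of_nat (k choose i) * X ^ i) * (\<Sum>j = 1..l. of_nat (l choose j) * X ^ j))"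
  proof -
    have "N = {A \<union> B | A B. A \<in> {Z} \<and> B \<in> W}" unfolding N_def by blast
    then have "size_enumerator N = size_enumerator {Z} * size_enumerator W"
      using size_enumerator_independent_unions[of Z "P \<union> Q" "{Z}" W] fins disj W_sub
      by (simp add: Int_Un_distrib Int_commute)
    moreover have "size_enumerator W =
        size_enumerator (Pow P - {{}}) * size_enumerator (Pow Q - {{}})"
      unfolding W_def
      by (rule size_enumerator_independent_unions[OF fins(2,3) disj(4)]) auto
    moreover have "size_enumerator {Z} = X ^ z"
      using z by (simp add: size_enumerator_def)
    ultimately show ?thesis
      by (simp only: size_enumerator_nonempty_subsets[OF fins(2)]
            size_enumerator_nonempty_subsets[OF fins(3)] k l)
  qed
  moreover have "size_enumerator {Z \<union> P, Z \<union> Q} = X ^ z * (X ^ k + X ^ l)"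
  proof -
    obtain v where "v \<in> P" using nonempty by blast
    then have "v \<notin> Z \<union> Q" "v \<in> Z \<union> P" using disj by auto
    then have "Z \<union> P \<noteq> Z \<union> Q" by blast
    moreover have "card (Z \<union> P) = z + k" "card (Z \<union> Q) = z + l"
      using disj fins k l z by (auto simp: card_Un_disjoint Int_commute)
    ultimately show ?thesis
      by (simp add: size_enumerator_def power_add algebra_simps)
  qed
  moreover have "size_enumerator (M \<union> (N \<union> {Z \<union> P, Z \<union> Q})) =
      size_enumerator M + (size_enumerator N + size_enumerator {Z \<union> P, Z \<union> Q})"
  proof -
    have "N \<inter> {Z \<union> P, Z \<union> Q} = {}"
    proof -
      have "C \<inter> P \<noteq> {} \<and> C \<inter> Q \<noteq> {}" if "C \<in> N" for C
        using that unfolding N_def W_def by auto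
      moreover have "(Z \<union> P) \<inter> Q = {}" "(Z \<union> Q) \<inter> P = {}" using disj by auto
      ultimately show ?thesis by fast
    qed
    moreover have "M \<inter> (N \<union> {Z \<union> P, Z \<union> Q}) = {}"
      using N_sub unfolding M_def by blast
    ultimately show ?thesis
      using finM finN
      by (simp only: size_enumerator_Un_disjoint finite_Un finite.intros simp_thms)
  qed
  moreover have "{S. dominating_set G S} = M \<union> (N \<union> {Z \<union> P, Z \<union> Q})"
    unfolding M_def N_def W_def using dominating_sets_by_classes[OF verts disj nonempty adj] .
  ultimately show ?thesis
    by (simp only: domination_poly_eq_size_enumerator[OF fin] distrib_left add.assoc)
qed

section \<open>The co-maximal graph modulo a product of two prime powers\<close>

text \<open>
  The sum of the two principal ideals is an ideal, hence the whole ring iff it contains $1$. This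
  means that $xa + yb \equiv 1$ is solvable modulo $n$, which is Bezout's criterion for
  $\gcd(a, b, n) = 1$.
\<close>

lemma comaximal_residues_iff:
  fixes a b :: int
  assumes n: "n \<ge> 2" and a: "a \<in> {0..<int n}" and b: "b \<in> {0..<int n}"
  shows "(a, b) \<in> parcs (comaximal_graph_Z n) \<longleftrightarrow> a \<noteq> b \<and> gcd (gcd a b) (int n) = 1"
proof -
  define R where "R = residue_ring (int n)"
  interpret residues "int n" R
    using n by unfold_locales (auto simp: R_def)
  have car: "carrier R = {0..<int n}"
    unfolding res_carrier_eq by auto
  have aR: "a \<in> carrier R" and bR: "b \<in> carrier R" using a b car by auto
  have one: "\<one>\<^bsub>R\<^esub> = 1" using one_cong n by simp
  define I where "I = (PIdl\<^bsub>R\<^esub> a) <+>\<^bsub>R\<^esub> (PIdl\<^bsub>R\<^esub> b)"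
  have "ideal I R"
    unfolding I_def by (intro add_ideals cgenideal_ideal aR bR)
  then have "I = carrier R \<longleftrightarrow> 1 \<in> I"
    using ideal.one_imp_carrier[of I R] one_closed unfolding one by blast
  also have "\<dots> \<longleftrightarrow> (\<exists>x\<in>{0..<int n}. \<exists>y\<in>{0..<int n}. 1 = (x * a + y * b) mod int n)"
  proof -
    have "1 \<in> I \<longleftrightarrow> (\<exists>x\<in>{0..<int n}. \<exists>y\<in>{0..<int n}. 1 = x \<otimes>\<^bsub>R\<^esub> a \<oplus>\<^bsub>R\<^esub> y \<otimes>\<^bsub>R\<^esub> b)"
      unfolding I_def set_add_def' cgenideal_def car by blast
    then show ?thesis
      by (simp add: res_mult_eq res_add_eq mod_simps)
  qed
  also have "\<dots> \<longleftrightarrow> gcd (gcd a b) (int n) = 1"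
  proof
    assume "\<exists>x\<in>{0..<int n}. \<exists>y\<in>{0..<int n}. 1 = (x * a + y * b) mod int n"
    then obtain x y where xy: "1 = (x * a + y * b) mod int n" by blast
    have "gcd (gcd a b) (int n) dvd (x * a + y * b) mod int n"
      by (intro dvd_mod dvd_add dvd_mult) (auto intro: dvd_trans)
    then show "gcd (gcd a b) (int n) = 1" unfolding xy[symmetric] by simp
  next
    assume g: "gcd (gcd a b) (int n) = 1"
    obtain s t where st: "s * gcd a b + t * int n = 1"
      using bezout_int[of "gcd a b" "int n"] g by auto
    obtain x y where xy: "x * a + y * b = gcd a b"
      using bezout_int[of a b] by auto
    have "((s * x mod int n) * a + (s * y mod int n) * b) mod int n = (s * x * a + s * y * b) mod int n"
      by (intro mod_add_cong mod_mult_cong) simp_all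
    also have "\<dots> = (s * (x * a + y * b)) mod int n" by (simp add: algebra_simps)
    also have "\<dots> = (s * gcd a b + t * int n) mod int n" unfolding xy by simp
    also have "\<dots> = 1" unfolding st using n by simp
    finally have "1 = ((s * x mod int n) * a + (s * y mod int n) * b) mod int n" ..
    then show "\<exists>x\<in>{0..<int n}. \<exists>y\<in>{0..<int n}. 1 = (x * a + y * b) mod int n"
      using n by (intro bexI[of _ "s * x mod int n"] bexI[of _ "s * y mod int n"]) auto
  qed
  finally have "I = carrier R \<longleftrightarrow> gcd (gcd a b) (int n) = 1" .
  then show ?thesis
    using aR bR by (simp add: comaximal_graph_def I_def flip: R_def)
qed

lemma coprime_two_prime_powers_iff:
  fixes c :: int
  assumes "prime p" "prime q" "n1 > 0" "n2 > 0"
  shows "coprime c (int (p ^ n1 * q ^ n2)) \<longleftrightarrow> \<not> int p dvd c \<and> \<not> int q dvd c"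
proof -
  have "coprime c (int r) \<longleftrightarrow> \<not> int r dvd c" if "prime r" for r :: nat
  proof -
    have "prime (int r)" using that by simp
    then show ?thesis
      by (metis coprime_absorb_right coprime_commute not_prime_unit prime_imp_coprime)
  qed
  then show ?thesis using assms by simp
qed

lemma adjacent_residues_iff:
  fixes a b :: int
  assumes p: "prime p" and q: "prime q" and e: "n1 > 0" "n2 > 0"
    and n: "n = p ^ n1 * q ^ n2" "n \<ge> 2" and ab: "a \<in> {0..<int n}" "b \<in> {0..<int n}"
  shows "(a, b) \<in> parcs (comaximal_graph_Z n) \<longleftrightarrow>
      a \<noteq> b \<and> \<not> (int p dvd a \<and> int p dvd b) \<and> \<not> (int q dvd a \<and> int q dvd b)"
  using coprime_two_prime_powers_iff[OF p q e, of "gcd a b"] comaximal_residues_iff[OF n(2) ab]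
  unfolding n(1) by (simp add: coprime_iff_gcd_eq_1)

lemma card_multiples_below:
  fixes n d :: nat
  assumes "d dvd n" "n > 0"
  shows "card {a \<in> {0..<int n}. int d dvd a} = n div d"
proof -
  obtain m where m: "n = d * m" using assms by blast
  then have d: "d > 0" using assms by simp
  have "{a \<in> {0..<int n}. int d dvd a} = (\<lambda>i. int d * int i) ` {..<m}"
  proof (rule Set.set_eqI)
    fix a
    have "a \<in> (\<lambda>i. int d * int i) ` {..<m}" if a: "a \<in> {0..<int n}" "int d dvd a"
    proof -
      obtain i where i: "a = int d * i" using a by blast
      then have "0 \<le> i" "i < int m" using a d m by (auto simp: zero_le_mult_iff)
      then show ?thesis using i by (intro image_eqI[of _ _ "nat i"]) auto
    qed
    moreover have "int d * int i < int n" if "i < m" for i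
      using that d m by (simp flip: of_nat_mult)
    ultimately show "a \<in> {a \<in> {0..<int n}. int d dvd a} \<longleftrightarrow> a \<in> (\<lambda>i. int d * int i) ` {..<m}"
      by auto
  qed
  moreover have "inj_on (\<lambda>i. int d * int i) {..<m}" using d by (auto simp: inj_on_def)
  ultimately show ?thesis using m d by (simp add: card_image)
qed

lemma card_coprime_residues:
  assumes "n \<ge> 2"
  shows "card {a \<in> {0..<int n}. coprime a (int n)} = totient n"
proof -
  \<comment> \<open>Totatives are taken from \<open>{1..n}\<close> and residues from \<open>{0..n - 1}\<close>; as $n \geq 2$, neither
    $0$ nor $n$ is coprime to $n$, so the two sets agree.\<close>
  have "{a \<in> {0..<int n}. coprime a (int n)} = int ` totatives n"
  proof (rule Set.set_eqI)
    fix a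
    have "a \<in> int ` totatives n" if a: "a \<in> {0..<int n}" "coprime a (int n)"
    proof -
      have "a \<noteq> 0" using a assms by auto
      then show ?thesis using a
        by (intro image_eqI[of _ _ "nat a"])
          (auto simp: totatives_def simp flip: coprime_int_iff)
    qed
    moreover have "k < n" if "k \<in> totatives n" for k
      using that assms by (auto simp: totatives_def le_less)
    ultimately show "a \<in> {a \<in> {0..<int n}. coprime a (int n)} \<longleftrightarrow> a \<in> int ` totatives n"
      by (auto simp: totatives_def)
  qed
  then show ?thesis by (simp add: card_image totient_def)
qed

lemma two_primes_dvd_iff:
  fixes p q :: nat and a :: int
  assumes "prime p" "prime q" "p \<noteq> q"
  shows "int p dvd a \<and> int q dvd a \<longleftrightarrow> int (p * q) dvd a"
  using assms
  by (auto intro!: divides_mult simp: primes_coprime intro: dvd_mult_left dvd_mult_right)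

text \<open>
  The multiples of $p$ that $q$ does not divide are what remains of the $n/p$ multiples of $p$
  after removing the $n/(pq)$ multiples of $pq$.
\<close>

lemma card_multiples_of_one_prime:
  fixes p q n :: nat
  assumes "prime p" "prime q" "p \<noteq> q" "p * q dvd n" "n > 0"
  shows "card {a \<in> {0..<int n}. int p dvd a \<and> \<not> int q dvd a} = n * (q - 1) div (p * q)"
proof -
  obtain m where m: "n = p * q * m" using assms by blast
  have pq: "p > 0" "q > 0" using assms prime_gt_0_nat by auto
  note both = two_primes_dvd_iff[OF assms(1-3)]
  have "{a \<in> {0..<int n}. int p dvd a \<and> \<not> int q dvd a} =
      {a \<in> {0..<int n}. int p dvd a} - {a \<in> {0..<int n}. int (p * q) dvd a}"
    using both by blast
  moreover have "{a \<in> {0..<int n}. int (p * q) dvd a} \<subseteq> {a \<in> {0..<int n}. int p dvd a}"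
    using both by blast
  moreover have "p dvd n" using m by simp
  moreover have "finite {a \<in> {0..<int n}. int (p * q) dvd a}"
    by (rule finite_subset[of _ "{0..<int n}"]) auto
  ultimately have "card {a \<in> {0..<int n}. int p dvd a \<and> \<not> int q dvd a} = n div p - n div (p * q)"
    using assms card_multiples_below[of p n] card_multiples_below[of "p * q" n]
    by (simp only: card_Diff_subset)
  also have "\<dots> = q * m - m" using m pq by simp
  also have "\<dots> = m * (q - 1)" by (simp add: diff_mult_distrib2 mult.commute)
  also have "\<dots> = (p * q) * (m * (q - 1)) div (p * q)" using pq by simp
  also have "\<dots> = n * (q - 1) div (p * q)" by (simp only: m mult.assoc)
  finally show ?thesis .
qed

lemma domination_poly_two_prime_powers:
  fixes n p q n1 n2 :: nat
  assumes p: "prime p" and q: "prime q" and pq: "p \<noteq> q"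
    and e: "n1 > 0" "n2 > 0" and n: "n = p ^ n1 * q ^ n2" "n \<ge> 2"
  shows "domination_poly (comaximal_graph_Z n) =
          (\<Sum>i = 0..n. of_nat (n choose i) * X ^ i)
          - (\<Sum>i = 0..n - totient n. of_nat (n - totient n choose i) * X ^ i)
          + X ^ (n div (p * q)) *
              ((\<Sum>i = 1..n * (q - 1) div (p * q). of_nat (n * (q - 1) div (p * q) choose i) * X ^ i)
               * (\<Sum>j = 1..n * (p - 1) div (p * q). of_nat (n * (p - 1) div (p * q) choose j) * X ^ j)
               + X ^ (n * (q - 1) div (p * q))
               + X ^ (n * (p - 1) div (p * q)))"
proof -
  define V where "V = {0..<int n}"
  define U where "U = {a \<in> V. \<not> int p dvd a \<and> \<not> int q dvd a}"
  define P where "P = {a \<in> V. int p dvd a \<and> \<not> int q dvd a}"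
  define Q where "Q = {a \<in> V. int q dvd a \<and> \<not> int p dvd a}"
  define Z where "Z = {a \<in> V. int p dvd a \<and> int q dvd a}"
  have npos: "n > 0" using n(2) by linarith
  have pqn: "p * q dvd n"
    unfolding n using e by (intro mult_dvd_mono dvd_power) auto
  have verts: "pverts (comaximal_graph_Z n) = V"
    by (auto simp: comaximal_graph_def residue_ring_def V_def)
  have cU: "card U = totient n"
    using card_coprime_residues[OF n(2)] coprime_two_prime_powers_iff[OF p q e]
    by (simp add: U_def V_def n(1))
  have cP: "card P = n * (q - 1) div (p * q)"
    unfolding P_def V_def by (rule card_multiples_of_one_prime[OF p q pq pqn npos])
  have cQ: "card Q = n * (p - 1) div (p * q)"
    unfolding Q_def V_def
    using card_multiples_of_one_prime[OF q p] pq pqn npos by (simp add: mult.commute)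
  have cZ: "card Z = n div (p * q)"
    unfolding Z_def V_def two_primes_dvd_iff[OF p q pq] by (rule card_multiples_below[OF pqn npos])
  have "p * q \<le> n" using pqn npos by (rule dvd_imp_le)
  moreover have "p < p * q" "q < p * q"
    using p q by (auto simp: prime_gt_0_nat prime_gt_Suc_0_nat)
  ultimately have "p < n" "q < n" by (meson less_le_trans)+
  then have "int p \<in> V" "int q \<in> V" by (auto simp: V_def)
  then have "int p \<in> P" "int q \<in> Q"
    using primes_dvd_imp_eq[OF p q] primes_dvd_imp_eq[OF q p] pq by (auto simp: P_def Q_def)
  then have ne: "P \<noteq> {}" "Q \<noteq> {}" by auto
  have adj: "(a, b) \<in> parcs (comaximal_graph_Z n) \<longleftrightarrow>
      a \<noteq> b \<and> (a \<in> U \<or> b \<in> U \<or> (a \<in> P \<and> b \<in> Q) \<or> (a \<in> Q \<and> b \<in> P))"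
    if "a \<in> V" "b \<in> V" for a b
    using adjacent_residues_iff[OF p q e n, of a b] that
    unfolding U_def P_def Q_def V_def by blast
  have cV: "card V = n" by (simp add: V_def)
  show ?thesis
    by (rule domination_poly_by_classes[where U = U and P = P and Q = Q and Z = Z])
      (use ne adj cU cP cQ cZ cV in \<open>auto simp: verts U_def P_def Q_def Z_def V_def\<close>)
qed

theorem theorem2p5:
  fixes n :: nat
  assumes "n \<ge> 2"
  shows
    "(\<forall>p q. prime p \<and> prime q \<and> p < q \<and> n = p * q \<longrightarrow>
        domination_poly (comaximal_graph_Z n) =
          (\<Sum>i = 0..p * q. of_nat (p * q choose i) * X ^ i)
          - (\<Sum>i = 0..p + q - 1. of_nat (p + q - 1 choose i) * X ^ i)
          + X * (\<Sum>i = 1..p - 1. of_nat (p - 1 choose i) * X ^ i)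
              * (\<Sum>j = 1..q - 1. of_nat (q - 1 choose j) * X ^ j)
          + X ^ p + X ^ q)
     \<and>
     (\<forall>p q n1 n2. prime p \<and> prime q \<and> p < q \<and> n1 > 0 \<and> n2 > 0 \<and> n = p ^ n1 * q ^ n2 \<longrightarrow>
        domination_poly (comaximal_graph_Z n) =
          (\<Sum>i = 0..n. of_nat (n choose i) * X ^ i)
          - (\<Sum>i = 0..n - totient n. of_nat (n - totient n choose i) * X ^ i)
          + X ^ (n div (p * q)) *
              ((\<Sum>i = 1..n * (q - 1) div (p * q). of_nat (n * (q - 1) div (p * q) choose i) * X ^ i)
               * (\<Sum>j = 1..n * (p - 1) div (p * q). of_nat (n * (p - 1) div (p * q) choose j) * X ^ j)
               + X ^ (n * (q - 1) div (p * q))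
               + X ^ (n * (p - 1) div (p * q))))"
proof (intro conjI allI impI; elim conjE)
  fix p q :: nat
  assume p: "prime p" and q: "prime q" and pq: "p < q" and n: "n = p * q"
  have pos: "p > 0" "q > 0" using p q by (auto simp: prime_gt_0_nat)
  have "coprime p q" using p q pq by (simp add: primes_coprime)
  then have "totient n = (p - 1) * (q - 1)"
    using p q n by (simp add: totient_mult_coprime totient_prime)
  also have "\<dots> = p * q - (p + q - 1)"
    using pos by (cases p; cases q) (auto simp: algebra_simps)
  finally have tot: "n - totient n = p + q - 1"
    using pos n by (cases p; cases q) auto
  have sizes: "n div (p * q) = 1" "n * (q - 1) div (p * q) = q - 1" "n * (p - 1) div (p * q) = p - 1"
    using pos n by auto
  have "X * X ^ (p - 1) = X ^ p" "X * X ^ (q - 1) = X ^ q"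
    using pos by (simp_all flip: power_Suc)
  moreover have "domination_poly (comaximal_graph_Z n) =
      (\<Sum>i = 0..n. of_nat (n choose i) * X ^ i)
      - (\<Sum>i = 0..p + q - 1. of_nat (p + q - 1 choose i) * X ^ i)
      + X * ((\<Sum>i = 1..q - 1. of_nat (q - 1 choose i) * X ^ i)
             * (\<Sum>j = 1..p - 1. of_nat (p - 1 choose j) * X ^ j) + X ^ (q - 1) + X ^ (p - 1))"
    using domination_poly_two_prime_powers[of p q 1 1 n] p q pq n assms
    unfolding tot sizes by simp
  ultimately show "domination_poly (comaximal_graph_Z n) =
          (\<Sum>i = 0..p * q. of_nat (p * q choose i) * X ^ i)
          - (\<Sum>i = 0..p + q - 1. of_nat (p + q - 1 choose i) * X ^ i)
          + X * (\<Sum>i = 1..p - 1. of_nat (p - 1 choose i) * X ^ i)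
              * (\<Sum>j = 1..q - 1. of_nat (q - 1 choose j) * X ^ j)
          + X ^ p + X ^ q"
    unfolding n by (simp only: distrib_left mult_ac add_ac)
qed (rule domination_poly_two_prime_powers; use assms in simp)

end
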